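(* Let $\mathcal{H}=(V,E)$ be a finite hypergraph with nonnegative hyperedge weights $w_e$, $e\in E$, and let $t=\max_{e\in E}|e|\ge2$. The weighted cut function of $\mathcal{H}$ is a $2\lfloor t/2-1\rfloor$-sos-submodular function on $2^V$.
   Context: A hypergraph $\mathcal{H}=(V,E)$ consists of a finite node set $V$, identified with $\{1,\dots,n\}$, and a finite set $E$ of hyperedges, each a nonempty subset of $V$. The weighted cut function maps $S\subseteq V$ to the sum of the weights $w_e$ of the hyperedges $e$ that contain at least one node from $S$ and at least one node from $V\setminus S$. The multilinear extension (MLE) of a set function $f:2^V\to\mathbb{R}$ is the unique multilinear polynomial $F\in\mathbb{R}[x_1,\dots,x_n]$ (every variable appears with power at most $1$ in every monomial) with $F(1_S)=f(S)$ for all $S\subseteq V$, where $1_S\in\{0,1\}^n$ is the indicator vector of $S$. For an ideal $I$ of a real polynomial ring, a polynomial $p$ is $\tau$-sos modulo $I$ if there are finitely many polynomials $q_1,\dots,q_m$ in that ring, each of degree at most $\tau$, with $p-\sum_{r=1}^m q_r^2\in I$. For $i\ne j$, $x_{-i,j}$ denotes the variables $x_1,\dots,x_n$ with $x_i,x_j$ removed, and $I_2[x_{-i,j}]=\langle x_k^2-x_k : k\neq i,j\rangle\subseteq\mathbb{R}[x_{-i,j}]$. The set function $f$ with MLE $F$ is $\tau$-sos-submodular if for all $i\neq j$ the polynomial $-\frac{\partial^2F(x)}{\partial x_i\partial x_j}$ (which does not involve $x_i,x_j$) is $\tau$-sos modulo $I_2[x_{-i,j}]$. *)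

theory Defs
  imports Complex_Main "HOL-Library.Poly_Mapping" "HOL-Library.Indicator_Function"
begin

text \<open>
  A real polynomial in the variables \<open>x\<^sub>i\<close> (\<open>i :: nat\<close>) is a finitely supported map from
  monomials to coefficients, a monomial being a finitely supported map from variables to exponents.
  The ring operations, in particular the convolution product, are those of
  \<^theory>\<open>HOL-Library.Poly_Mapping\<close>.
\<close>

type_synonym monom = "nat \<Rightarrow>\<^sub>0 nat"
type_synonym mpoly = "monom \<Rightarrow>\<^sub>0 real"

definition X :: "nat \<Rightarrow> mpoly" where
  "X i = Poly_Mapping.single (Poly_Mapping.single i 1) 1"

definition vars :: "mpoly \<Rightarrow> nat set" where
  "vars p = (\<Union>m\<in>Poly_Mapping.keys p. Poly_Mapping.keys m)"

definition poly_ring :: "nat set \<Rightarrow> mpoly set" where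
  "poly_ring A = {p. vars p \<subseteq> A}"

definition monom_degree :: "monom \<Rightarrow> nat" where
  "monom_degree m = (\<Sum>i\<in>Poly_Mapping.keys m. Poly_Mapping.lookup m i)"

text \<open>The zero polynomial gets degree \<open>0\<close>; below only upper bounds on degrees matter.\<close>

definition total_degree :: "mpoly \<Rightarrow> nat" where
  "total_degree p = Max (insert 0 (monom_degree ` Poly_Mapping.keys p))"

definition eval_poly :: "(nat \<Rightarrow> real) \<Rightarrow> mpoly \<Rightarrow> real" where
  "eval_poly a p =
    (\<Sum>m\<in>Poly_Mapping.keys p.
       Poly_Mapping.lookup p m * (\<Prod>i\<in>Poly_Mapping.keys m. a i ^ Poly_Mapping.lookup m i))"

text \<open>
  Formal partial derivative. The subtraction of exponents is truncated, but where it truncates the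
  factor \<open>lookup m i\<close> vanishes.
\<close>

definition pdiff :: "nat \<Rightarrow> mpoly \<Rightarrow> mpoly" where
  "pdiff i p =
    (\<Sum>m\<in>Poly_Mapping.keys p.
       Poly_Mapping.single (m - Poly_Mapping.single i 1)
         (real (Poly_Mapping.lookup m i) * Poly_Mapping.lookup p m))"

text \<open>The ideal of the ring \<open>R\<close> (a subring of the full polynomial ring) generated by \<open>G \<subseteq> R\<close>.\<close>

definition ideal_generated :: "mpoly set \<Rightarrow> mpoly set \<Rightarrow> mpoly set" where
  "ideal_generated R G =
    {\<Sum>g\<in>B. a g * g | a B. finite B \<and> B \<subseteq> G \<and> (\<forall>g\<in>B. a g \<in> R)}"

definition I2 :: "nat set \<Rightarrow> mpoly set" where
  "I2 A = ideal_generated (poly_ring A) {X k ^ 2 - X k | k. k \<in> A}"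

definition sos_modulo :: "nat set \<Rightarrow> nat \<Rightarrow> mpoly set \<Rightarrow> mpoly \<Rightarrow> bool" where
  "sos_modulo A \<tau> I p \<longleftrightarrow>
    (\<exists>(m::nat) q. (\<forall>r<m. q r \<in> poly_ring A \<and> total_degree (q r) \<le> \<tau>) \<and>
       p - (\<Sum>r<m. q r ^ 2) \<in> I)"

definition multilinear :: "mpoly \<Rightarrow> bool" where
  "multilinear p \<longleftrightarrow> (\<forall>m\<in>Poly_Mapping.keys p. \<forall>i. Poly_Mapping.lookup m i \<le> 1)"

text \<open>Set functions on \<open>2\<^sup>V\<close> are total functions of which only the values on subsets of \<open>V\<close> are used.\<close>

definition mle :: "nat set \<Rightarrow> (nat set \<Rightarrow> real) \<Rightarrow> mpoly" where
  "mle V f =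
    (THE F. F \<in> poly_ring V \<and> multilinear F \<and> (\<forall>S\<subseteq>V. eval_poly (indicator S) F = f S))"

definition sos_submodular :: "nat set \<Rightarrow> nat \<Rightarrow> (nat set \<Rightarrow> real) \<Rightarrow> bool" where
  "sos_submodular V \<tau> f \<longleftrightarrow>
    (\<forall>i\<in>V. \<forall>j\<in>V. i \<noteq> j \<longrightarrow>
       sos_modulo (V - {i, j}) \<tau> (I2 (V - {i, j})) (- pdiff i (pdiff j (mle V f))))"

definition hypergraph :: "nat set \<Rightarrow> nat set set \<Rightarrow> bool" where
  "hypergraph V E \<longleftrightarrow> finite V \<and> finite E \<and> (\<forall>e\<in>E. e \<noteq> {} \<and> e \<subseteq> V)"

definition cut_function :: "nat set \<Rightarrow> nat set set \<Rightarrow> (nat set \<Rightarrow> real) \<Rightarrow> nat set \<Rightarrow> real" where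
  "cut_function V E w S = (\<Sum>e | e \<in> E \<and> e \<inter> S \<noteq> {} \<and> e \<inter> (V - S) \<noteq> {}. w e)"

end

theory Submission
  imports Defs
begin

text \<open>
  A hyperedge \<open>e\<close> is cut by \<open>S\<close> unless \<open>S\<close> contains it or misses it, so the cut function of \<open>e\<close>
  has the multilinear extension \<open>F\<^sub>e = 1 - \<Prod>\<^sub>e x\<^sub>k - \<Prod>\<^sub>e (1 - x\<^sub>k)\<close>. If \<open>i \<noteq> j\<close> lie in \<open>e\<close> and
  \<open>B = e - {i, j}\<close>, then \<open>-\<partial>\<^sub>i\<partial>\<^sub>jF\<^sub>e = a + b\<close> with \<open>a = \<Prod>\<^sub>B x\<^sub>k\<close> and \<open>b = \<Prod>\<^sub>B (1 - x\<^sub>k)\<close>; otherwise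
  the derivative vanishes.

  Modulo the relations \<open>x\<^sub>k\<^sup>2 = x\<^sub>k\<close> both \<open>a\<close> and \<open>b\<close> are idempotent, so \<open>a + b\<close> is congruent to
  \<open>a\<^sup>2 + b\<^sup>2\<close>, a sum of squares of polynomials of degree \<open>|B| \<le> t - 2\<close>. The bound
  \<open>2\<lfloor>t/2 - 1\<rfloor>\<close> is the largest even number not above \<open>t - 2\<close>, so this settles even \<open>|B|\<close>. If \<open>|B|\<close> is
  odd, then \<open>ab\<close> lies in the ideal because it contains a factor \<open>x\<^sub>k(1 - x\<^sub>k)\<close>; hence \<open>a + b\<close> is
  itself idempotent, congruent to the single square \<open>(a + b)\<^sup>2\<close>. Moreover the
  leading terms \<open>\<Prod>\<^sub>B x\<^sub>k\<close> and \<open>(-1)\<^bsup>|B|\<^esup> \<Prod>\<^sub>B x\<^sub>k\<close> cancel, which brings the degree of \<open>a + b\<close> down to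
  the even number \<open>|B| - 1\<close>. Both cases are in \<open>sos_modulo_prod_X_add_prod_one_minus_X\<close>.

  Nonnegative combinations of such polynomials remain sums of squares, and \<open>mle_eqI\<close> (a multilinear
  polynomial is determined by its values on indicator vectors) identifies \<open>\<Sum> w\<^sub>e F\<^sub>e\<close> as the
  multilinear extension of the weighted cut function.
\<close>

section \<open>Monomials of sums and products\<close>

text \<open>
  Lying in \<open>poly_ring A\<close>, being multilinear and having bounded degree all say that the monomials
  of a polynomial belong to a certain set. The closure properties are therefore proved for
  an arbitrary set of monomials.
\<close>

lemma keys_add_subset:
  fixes p q :: mpoly
  assumes "Poly_Mapping.keys p \<subseteq> M" "Poly_Mapping.keys q \<subseteq> M"
  shows "Poly_Mapping.keys (p + q) \<subseteq> M"
  using assms keys_add[of p q] by blast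

lemma keys_uminus: "Poly_Mapping.keys (- p) = Poly_Mapping.keys (p :: mpoly)"
  by (auto simp: in_keys_iff)

lemma keys_diff_subset:
  fixes p q :: mpoly
  assumes "Poly_Mapping.keys p \<subseteq> M" "Poly_Mapping.keys q \<subseteq> M"
  shows "Poly_Mapping.keys (p - q) \<subseteq> M"
  using keys_add_subset[of p M "- q"] assms by (simp add: keys_uminus)

lemma keys_sum_subset:
  fixes p :: "'a \<Rightarrow> mpoly"
  assumes "\<And>i. i \<in> I \<Longrightarrow> Poly_Mapping.keys (p i) \<subseteq> M"
  shows "Poly_Mapping.keys (\<Sum>i\<in>I. p i) \<subseteq> M"
  using assms by (induction I rule: infinite_finite_induct) (simp_all add: keys_add_subset)

lemma keys_mult_subset:
  fixes p q :: mpoly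
  assumes "Poly_Mapping.keys p \<subseteq> M" "Poly_Mapping.keys q \<subseteq> N"
    and "\<And>a b. a \<in> M \<Longrightarrow> b \<in> N \<Longrightarrow> a + b \<in> L"
  shows "Poly_Mapping.keys (p * q) \<subseteq> L"
  using keys_mult[of p q] assms by blast

lemma keys_add_monom:
  "Poly_Mapping.keys (m + m') = Poly_Mapping.keys m \<union> Poly_Mapping.keys (m' :: monom)"
  by (auto simp: in_keys_iff lookup_add)

lemma monom_degree_superset:
  assumes "finite K" "Poly_Mapping.keys m \<subseteq> K"
  shows "monom_degree m = (\<Sum>i\<in>K. Poly_Mapping.lookup m i)"
  unfolding monom_degree_def
  by (rule sum.mono_neutral_left) (use assms in \<open>auto simp: in_keys_iff\<close>)

lemma monom_degree_add: "monom_degree (m + m') = monom_degree m + monom_degree m'"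
proof -
  let ?K = "Poly_Mapping.keys m \<union> Poly_Mapping.keys m'"
  have "monom_degree (m + m') = (\<Sum>i\<in>?K. Poly_Mapping.lookup (m + m') i)"
    by (rule monom_degree_superset) (auto simp: keys_add_monom)
  also have "\<dots> = monom_degree m + monom_degree m'"
    by (simp add: monom_degree_superset[of ?K] lookup_add sum.distrib)
  finally show ?thesis .
qed

lemma monom_degree_zero [simp]: "monom_degree 0 = 0"
  by (simp add: monom_degree_def)

lemma monom_degree_single [simp]: "monom_degree (Poly_Mapping.single i c) = c"
  by (simp add: monom_degree_def)

lemma keys_X [simp]: "Poly_Mapping.keys (X i) = {Poly_Mapping.single i 1}"
  by (simp add: X_def)

lemma total_degree_le_iff:
  "total_degree p \<le> d \<longleftrightarrow> Poly_Mapping.keys p \<subseteq> {m. monom_degree m \<le> d}"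
  unfolding total_degree_def by (subst Max_le_iff) auto

lemma total_degree_mult_le:
  assumes "total_degree p \<le> d" "total_degree q \<le> d'"
  shows "total_degree (p * q) \<le> d + d'"
  using assms unfolding total_degree_le_iff
  by (rule keys_mult_subset) (auto simp: monom_degree_add)

lemma total_degree_const [simp]: "total_degree (Poly_Mapping.single 0 c) = 0"
  by (simp add: total_degree_def)

lemma total_degree_one [simp]: "total_degree 1 = 0"
  by (simp add: total_degree_def)

lemma total_degree_X: "total_degree (X i) \<le> 1"
  by (simp add: total_degree_le_iff)

lemma total_degree_one_minus_X: "total_degree (1 - X i) \<le> 1"
  unfolding total_degree_le_iff by (rule keys_diff_subset) auto

lemma total_degree_prod_le:
  assumes "\<And>i. i \<in> I \<Longrightarrow> total_degree (p i) \<le> 1"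
  shows "total_degree (\<Prod>i\<in>I. p i) \<le> card I"
  using assms
proof (induction I rule: infinite_finite_induct)
  case (insert i I)
  then show ?case using total_degree_mult_le[of "p i" 1 "prod p I" "card I"] by simp
qed auto

section \<open>The polynomial ring in a set of variables\<close>

lemma poly_ring_iff: "p \<in> poly_ring A \<longleftrightarrow> Poly_Mapping.keys p \<subseteq> {m. Poly_Mapping.keys m \<subseteq> A}"
  by (auto simp: poly_ring_def vars_def)

lemma poly_ring_add: "p \<in> poly_ring A \<Longrightarrow> q \<in> poly_ring A \<Longrightarrow> p + q \<in> poly_ring A"
  unfolding poly_ring_iff by (rule keys_add_subset)

lemma poly_ring_diff: "p \<in> poly_ring A \<Longrightarrow> q \<in> poly_ring A \<Longrightarrow> p - q \<in> poly_ring A"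
  unfolding poly_ring_iff by (rule keys_diff_subset)

lemma poly_ring_uminus: "p \<in> poly_ring A \<Longrightarrow> - p \<in> poly_ring A"
  unfolding poly_ring_iff by (simp add: keys_uminus)

lemma poly_ring_mult: "p \<in> poly_ring A \<Longrightarrow> q \<in> poly_ring A \<Longrightarrow> p * q \<in> poly_ring A"
  unfolding poly_ring_iff by (rule keys_mult_subset) (auto simp: keys_add_monom)

lemma poly_ring_zero [simp]: "0 \<in> poly_ring A"
  by (simp add: poly_ring_iff)

lemma poly_ring_one [simp]: "1 \<in> poly_ring A"
  by (simp add: poly_ring_iff)

lemma poly_ring_const [simp]: "Poly_Mapping.single 0 c \<in> poly_ring A"
  by (simp add: poly_ring_iff)

lemma poly_ring_X: "i \<in> A \<Longrightarrow> X i \<in> poly_ring A"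
  by (simp add: poly_ring_iff)

lemma poly_ring_sum: "(\<And>i. i \<in> I \<Longrightarrow> p i \<in> poly_ring A) \<Longrightarrow> (\<Sum>i\<in>I. p i) \<in> poly_ring A"
  unfolding poly_ring_iff by (rule keys_sum_subset)

lemma poly_ring_prod: "(\<And>i. i \<in> I \<Longrightarrow> p i \<in> poly_ring A) \<Longrightarrow> (\<Prod>i\<in>I. p i) \<in> poly_ring A"
  by (induction I rule: infinite_finite_induct) (auto intro: poly_ring_mult)

lemma poly_ring_mono: "A \<subseteq> B \<Longrightarrow> p \<in> poly_ring A \<Longrightarrow> p \<in> poly_ring B"
  by (auto simp: poly_ring_def)

lemma mpoly_eq_sum_monomials:
  "(p :: mpoly) = (\<Sum>m\<in>Poly_Mapping.keys p. Poly_Mapping.single m (Poly_Mapping.lookup p m))"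
  by (rule poly_mapping_eqI) (auto simp: lookup_sum lookup_single when_def in_keys_iff)

lemma mpoly_induct [case_names monomial add]:
  fixes p :: mpoly
  assumes monomial: "\<And>m c. P (Poly_Mapping.single m c)"
    and add: "\<And>p q. P p \<Longrightarrow> P q \<Longrightarrow> P (p + q)"
  shows "P p"
proof -
  have "P (\<Sum>m\<in>K. Poly_Mapping.single m (Poly_Mapping.lookup p m))" if "finite K" for K
    using that monomial[of 0 0] by (induction K) (auto intro: assms)
  then show ?thesis
    by (subst mpoly_eq_sum_monomials) simp
qed

section \<open>Evaluation\<close>

lemma eval_poly_monomial:
  "eval_poly a (Poly_Mapping.single m c) =
    c * (\<Prod>i\<in>Poly_Mapping.keys m. a i ^ Poly_Mapping.lookup m i)"
  by (simp add: eval_poly_def)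

lemma eval_poly_add: "eval_poly a (p + q) = eval_poly a p + eval_poly a q"
  unfolding eval_poly_def
  by (rule setsum_keys_plus_distrib[where f = "\<lambda>m c. c * (\<Prod>i\<in>Poly_Mapping.keys m. a i ^ Poly_Mapping.lookup m i)"])
    (simp_all add: distrib_right)

lemma eval_poly_uminus: "eval_poly a (- p) = - eval_poly a p"
  by (simp add: eval_poly_def keys_uminus sum_negf)

lemma eval_poly_diff: "eval_poly a (p - q) = eval_poly a p - eval_poly a q"
  using eval_poly_add[of a p "- q"] by (simp add: eval_poly_uminus)

lemma eval_poly_zero [simp]: "eval_poly a 0 = 0"
  by (simp add: eval_poly_def)

lemma eval_poly_one [simp]: "eval_poly a 1 = 1"
  by (simp add: eval_poly_def)

lemma eval_poly_const [simp]: "eval_poly a (Poly_Mapping.single 0 c) = c"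
  by (simp add: eval_poly_monomial)

lemma eval_poly_X [simp]: "eval_poly a (X i) = a i"
  by (simp add: X_def eval_poly_monomial)

lemma eval_monom_add:
  fixes a :: "nat \<Rightarrow> real" and m m' :: monom
  shows "(\<Prod>i\<in>Poly_Mapping.keys (m + m'). a i ^ Poly_Mapping.lookup (m + m') i) =
    (\<Prod>i\<in>Poly_Mapping.keys m. a i ^ Poly_Mapping.lookup m i) *
    (\<Prod>i\<in>Poly_Mapping.keys m'. a i ^ Poly_Mapping.lookup m' i)"
proof -
  let ?K = "Poly_Mapping.keys m \<union> Poly_Mapping.keys m'"
  have superset: "(\<Prod>i\<in>Poly_Mapping.keys k. a i ^ Poly_Mapping.lookup k i) =
      (\<Prod>i\<in>?K. a i ^ Poly_Mapping.lookup k i)"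
    if "Poly_Mapping.keys k \<subseteq> ?K" for k :: monom
    by (rule prod.mono_neutral_left) (use that in \<open>auto simp: in_keys_iff\<close>)
  show ?thesis
    by (simp add: superset keys_add_monom lookup_add power_add prod.distrib)
qed

lemma eval_poly_mult: "eval_poly a (p * q) = eval_poly a p * eval_poly a q"
proof (induction p rule: mpoly_induct)
  case (monomial m c)
  show ?case
  proof (induction q rule: mpoly_induct)
    case (monomial m' c')
    show ?case by (simp add: mult_single eval_poly_monomial eval_monom_add)
  qed (simp add: eval_poly_add algebra_simps)
qed (simp add: eval_poly_add algebra_simps)

lemma eval_poly_sum: "eval_poly a (\<Sum>i\<in>I. p i) = (\<Sum>i\<in>I. eval_poly a (p i))"
  by (induction I rule: infinite_finite_induct) (simp_all add: eval_poly_add)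

lemma eval_poly_prod: "eval_poly a (\<Prod>i\<in>I. p i) = (\<Prod>i\<in>I. eval_poly a (p i))"
  by (induction I rule: infinite_finite_induct) (simp_all add: eval_poly_mult)

section \<open>Uniqueness of the multilinear extension\<close>

lemma multilinear_iff:
  "multilinear p \<longleftrightarrow> Poly_Mapping.keys p \<subseteq> {m. \<forall>i. Poly_Mapping.lookup m i \<le> 1}"
  by (auto simp: multilinear_def)

lemma multilinear_diff: "multilinear p \<Longrightarrow> multilinear q \<Longrightarrow> multilinear (p - q)"
  unfolding multilinear_iff by (rule keys_diff_subset)

lemma multilinear_sum: "(\<And>i. i \<in> I \<Longrightarrow> multilinear (p i)) \<Longrightarrow> multilinear (\<Sum>i\<in>I. p i)"
  unfolding multilinear_iff by (rule keys_sum_subset)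

lemma multilinear_one [simp]: "multilinear 1"
  by (simp add: multilinear_def)

lemma multilinear_const_mult: "multilinear p \<Longrightarrow> multilinear (Poly_Mapping.single 0 c * p)"
  unfolding multilinear_iff by (rule keys_mult_subset[where M = "{0}"]) auto

lemma multilinear_X_mult:
  assumes "multilinear p" "p \<in> poly_ring A" "k \<notin> A"
  shows "multilinear (X k * p)"
  unfolding multilinear_iff
proof (rule keys_mult_subset)
  show "Poly_Mapping.keys (X k) \<subseteq> {Poly_Mapping.single k 1}"
    by simp
  show "Poly_Mapping.keys p \<subseteq>
      {m. (\<forall>i. Poly_Mapping.lookup m i \<le> 1) \<and> Poly_Mapping.keys m \<subseteq> A}"
    using assms by (auto simp: multilinear_iff poly_ring_iff)
qed (use assms in \<open>auto simp: lookup_add lookup_single when_def in_keys_iff\<close>)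

text \<open>
  Among the monomials of \<open>p\<close>, choose one, \<open>m\<close>, that uses a minimal number of variables. At the
  indicator vector of the variables of \<open>m\<close>, a monomial survives only if its variables are among
  those of \<open>m\<close>; by minimality it then has the same variables as \<open>m\<close>, and being multilinear it
  equals \<open>m\<close>. So the value there is the coefficient of \<open>m\<close>.
\<close>

lemma multilinear_eq_zero:
  assumes "multilinear p" "p \<in> poly_ring V"
    and eval: "\<And>S. S \<subseteq> V \<Longrightarrow> eval_poly (indicator S) p = 0"
  shows "p = 0"
proof (rule ccontr)
  assume "p \<noteq> 0"
  then have "\<exists>m. m \<in> Poly_Mapping.keys p"
    by (metis in_keys_iff lookup_zero poly_mapping_eqI)
  then obtain m where m: "m \<in> Poly_Mapping.keys p"
    and minimal: "\<And>m'. m' \<in> Poly_Mapping.keys p \<Longrightarrow>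
      card (Poly_Mapping.keys m) \<le> card (Poly_Mapping.keys m')"
    using ex_has_least_nat[of "\<lambda>m. m \<in> Poly_Mapping.keys p" _ "\<lambda>m. card (Poly_Mapping.keys m)"]
    by blast
  define S where "S = Poly_Mapping.keys m"
  have monom_value: "(\<Prod>i\<in>Poly_Mapping.keys m'. indicator S i ^ Poly_Mapping.lookup m' i) =
      (if m' = m then 1 else (0::real))" if m': "m' \<in> Poly_Mapping.keys p" for m'
  proof (cases "m' = m")
    case True
    then show ?thesis by (simp add: S_def)
  next
    case False
    have "\<not> Poly_Mapping.keys m' \<subseteq> S"
    proof
      assume "Poly_Mapping.keys m' \<subseteq> S"
      then have same: "Poly_Mapping.keys m' = Poly_Mapping.keys m"
        using minimal[OF m'] by (simp add: S_def card_seteq)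
      have "Poly_Mapping.lookup k i = (if i \<in> Poly_Mapping.keys k then 1 else 0)"
        if "k \<in> Poly_Mapping.keys p" for k i
        using that \<open>multilinear p\<close> unfolding multilinear_def
        by (metis in_keys_iff le_0_eq le_Suc_eq One_nat_def)
      then have "m' = m"
        using m m' same by (intro poly_mapping_eqI) simp
      with False show False ..
    qed
    then obtain i where "i \<in> Poly_Mapping.keys m'" "i \<notin> S"
      by blast
    then show ?thesis
      using False by (auto simp: in_keys_iff intro!: bexI[of _ i])
  qed
  have "eval_poly (indicator S) p =
      (\<Sum>m'\<in>Poly_Mapping.keys p. if m' = m then Poly_Mapping.lookup p m' else 0)"
    unfolding eval_poly_def by (rule sum.cong) (simp_all add: monom_value)
  also have "\<dots> = Poly_Mapping.lookup p m"
    using m by (simp add: sum.delta')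
  finally have "eval_poly (indicator S) p = Poly_Mapping.lookup p m" .
  moreover have "S \<subseteq> V"
    using m \<open>p \<in> poly_ring V\<close> by (auto simp: S_def poly_ring_iff)
  ultimately show False
    using eval m by (simp add: in_keys_iff)
qed

lemma mle_eqI:
  assumes "F \<in> poly_ring V" "multilinear F" "\<And>S. S \<subseteq> V \<Longrightarrow> eval_poly (indicator S) F = f S"
  shows "mle V f = F"
  unfolding mle_def
proof (rule the_equality)
  fix G
  assume G: "G \<in> poly_ring V \<and> multilinear G \<and> (\<forall>S\<subseteq>V. eval_poly (indicator S) G = f S)"
  have "G - F = 0"
    by (rule multilinear_eq_zero[of _ V])
      (use G assms in \<open>auto intro: multilinear_diff poly_ring_diff simp: eval_poly_diff\<close>)
  then show "G = F" by simp
qed (use assms in auto)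

section \<open>Partial derivatives\<close>

lemma pdiff_add: "pdiff i (p + q) = pdiff i p + pdiff i q"
  unfolding pdiff_def
  by (rule setsum_keys_plus_distrib[where f = "\<lambda>m c. Poly_Mapping.single (m - Poly_Mapping.single i 1)
      (real (Poly_Mapping.lookup m i) * c)"]) (simp_all add: distrib_left single_add)

lemma pdiff_uminus: "pdiff i (- p) = - pdiff i p"
  by (simp add: pdiff_def keys_uminus sum_negf single_uminus)

lemma pdiff_diff: "pdiff i (p - q) = pdiff i p - pdiff i q"
  using pdiff_add[of i p "- q"] by (simp add: pdiff_uminus)

lemma pdiff_zero [simp]: "pdiff i 0 = 0"
  by (simp add: pdiff_def)

lemma pdiff_sum: "pdiff i (\<Sum>k\<in>I. p k) = (\<Sum>k\<in>I. pdiff i (p k))"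
  by (induction I rule: infinite_finite_induct) (simp_all add: pdiff_add)

lemma pdiff_monomial:
  "pdiff i (Poly_Mapping.single m c) =
    Poly_Mapping.single (m - Poly_Mapping.single i 1) (real (Poly_Mapping.lookup m i) * c)"
  by (simp add: pdiff_def)

lemma pdiff_const_mult:
  "pdiff i (Poly_Mapping.single 0 c * p) = Poly_Mapping.single 0 c * pdiff i p"
  by (induction p rule: mpoly_induct)
    (simp_all add: mult_single pdiff_monomial pdiff_add distrib_left mult.left_commute)

lemma pdiff_eq_zero:
  assumes "p \<in> poly_ring A" "i \<notin> A"
  shows "pdiff i p = 0"
  unfolding pdiff_def
proof (rule sum.neutral, intro ballI)
  fix m assume "m \<in> Poly_Mapping.keys p"
  then have "Poly_Mapping.lookup m i = 0"
    using assms by (auto simp: poly_ring_iff simp flip: not_in_keys_iff_lookup_eq_zero)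
  then show "Poly_Mapping.single (m - Poly_Mapping.single i 1)
      (real (Poly_Mapping.lookup m i) * Poly_Mapping.lookup p m) = 0"
    by simp
qed

text \<open>
  Since \<open>i\<close> enters the polynomials in question only through a factor \<open>x\<^sub>i\<close> or \<open>1 - x\<^sub>i\<close>, this
  and \<open>pdiff_eq_zero\<close> take the place of the product rule.
\<close>

lemma pdiff_X_mult:
  assumes "p \<in> poly_ring A" "i \<notin> A"
  shows "pdiff i (X i * p) = p"
proof -
  have free: "Poly_Mapping.lookup m i = 0" if "m \<in> Poly_Mapping.keys p" for m
    using assms that by (auto simp: poly_ring_iff simp flip: not_in_keys_iff_lookup_eq_zero)
  have "pdiff i (X i * p) = pdiff i (X i *
      (\<Sum>m\<in>Poly_Mapping.keys p. Poly_Mapping.single m (Poly_Mapping.lookup p m)))"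
    by (simp flip: mpoly_eq_sum_monomials)
  also have "\<dots> = (\<Sum>m\<in>Poly_Mapping.keys p. Poly_Mapping.single m (Poly_Mapping.lookup p m))"
    unfolding sum_distrib_left pdiff_sum
    by (rule sum.cong) (simp_all add: X_def mult_single pdiff_monomial lookup_add free)
  finally show ?thesis
    by (simp flip: mpoly_eq_sum_monomials)
qed

section \<open>The ideal of the hypercube\<close>

lemma I2_I:
  assumes "finite B" "B \<subseteq> {X k ^ 2 - X k | k. k \<in> A}" "\<And>g. g \<in> B \<Longrightarrow> a g \<in> poly_ring A"
  shows "(\<Sum>g\<in>B. a g * g) \<in> I2 A"
  unfolding I2_def ideal_generated_def mem_Collect_eq
  by (rule exI[of _ a], rule exI[of _ B]) (use assms in simp)

lemma I2_E:
  assumes "p \<in> I2 A"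
  obtains a B where "p = (\<Sum>g\<in>B. a g * g)" "finite B" "B \<subseteq> {X k ^ 2 - X k | k. k \<in> A}"
    "\<And>g. g \<in> B \<Longrightarrow> a g \<in> poly_ring A"
  using assms unfolding I2_def ideal_generated_def by blast

lemma I2_add:
  assumes "p \<in> I2 A" "q \<in> I2 A"
  shows "p + q \<in> I2 A"
proof -
  obtain a B where p: "p = (\<Sum>g\<in>B. a g * g)" "finite B" "B \<subseteq> {X k ^ 2 - X k | k. k \<in> A}"
    "\<And>g. g \<in> B \<Longrightarrow> a g \<in> poly_ring A"
    using assms(1) by (rule I2_E) blast
  obtain b C where q: "q = (\<Sum>g\<in>C. b g * g)" "finite C" "C \<subseteq> {X k ^ 2 - X k | k. k \<in> A}"
    "\<And>g. g \<in> C \<Longrightarrow> b g \<in> poly_ring A"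
    using assms(2) by (rule I2_E) blast
  define c where "c g = (if g \<in> B then a g else 0) + (if g \<in> C then b g else 0)" for g
  have "(\<Sum>g\<in>B \<union> C. c g * g) =
      (\<Sum>g\<in>B \<union> C. if g \<in> B then a g * g else 0) + (\<Sum>g\<in>B \<union> C. if g \<in> C then b g * g else 0)"
    unfolding sum.distrib[symmetric] by (rule sum.cong) (auto simp: c_def distrib_right)
  also have "\<dots> = p + q"
    using p(2) q(2) by (simp add: p(1) q(1) sum.If_cases Int_absorb1)
  finally have "p + q = (\<Sum>g\<in>B \<union> C. c g * g)" ..
  moreover have "(\<Sum>g\<in>B \<union> C. c g * g) \<in> I2 A"
  proof (rule I2_I)
    show "B \<union> C \<subseteq> {X k ^ 2 - X k | k. k \<in> A}"
      using p(3) q(3) by (rule Un_least)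
    show "c g \<in> poly_ring A" if "g \<in> B \<union> C" for g
      using p(4) q(4) by (auto simp: c_def intro: poly_ring_add)
  qed (use p(2) q(2) in simp)
  ultimately show ?thesis
    by simp
qed

lemma I2_mult:
  assumes "r \<in> poly_ring A" "p \<in> I2 A"
  shows "r * p \<in> I2 A"
  using assms(2)
proof (rule I2_E)
  fix a B
  assume p: "p = (\<Sum>g\<in>B. a g * g)" and B: "finite B" "B \<subseteq> {X k ^ 2 - X k | k. k \<in> A}"
    and a: "\<And>g. g \<in> B \<Longrightarrow> a g \<in> poly_ring A"
  have "r * p = (\<Sum>g\<in>B. (r * a g) * g)"
    by (simp add: p sum_distrib_left mult.assoc)
  also have "\<dots> \<in> I2 A"
    using B assms(1) a by (intro I2_I poly_ring_mult)
  finally show ?thesis .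
qed

lemma I2_zero [simp]: "0 \<in> I2 A"
  using I2_I[of "{}"] by simp

lemma I2_uminus: "p \<in> I2 A \<Longrightarrow> - p \<in> I2 A"
  using I2_mult[of "- 1" A p] by (simp add: poly_ring_uminus)

lemma I2_generator: "k \<in> A \<Longrightarrow> X k ^ 2 - X k \<in> I2 A"
  using I2_I[of "{X k ^ 2 - X k}" A "\<lambda>_. 1"] by auto

lemma I2_idempotent_mult:
  assumes "p \<in> poly_ring A" "q \<in> poly_ring A" "p ^ 2 - p \<in> I2 A" "q ^ 2 - q \<in> I2 A"
  shows "(p * q) ^ 2 - p * q \<in> I2 A"
proof -
  have "(p * q) ^ 2 - p * q = (p * p) * (q ^ 2 - q) + q * (p ^ 2 - p)"
    by (simp add: power2_eq_square algebra_simps)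
  then show ?thesis
    using assms by (auto intro!: I2_add I2_mult poly_ring_mult)
qed

lemma I2_idempotent_prod:
  assumes "\<And>i. i \<in> I \<Longrightarrow> p i \<in> poly_ring A" "\<And>i. i \<in> I \<Longrightarrow> p i ^ 2 - p i \<in> I2 A"
  shows "(\<Prod>i\<in>I. p i) ^ 2 - (\<Prod>i\<in>I. p i) \<in> I2 A"
  using assms
proof (induction I rule: infinite_finite_induct)
  case (insert i I)
  then show ?case by (simp add: I2_idempotent_mult poly_ring_prod)
qed simp_all

lemma I2_one_minus_X: "k \<in> A \<Longrightarrow> (1 - X k) ^ 2 - (1 - X k) \<in> I2 A"
  using I2_generator[of k A] by (simp add: power2_eq_square algebra_simps)

section \<open>Sums of squares\<close>

lemma sos_modulo_zero: "sos_modulo A \<tau> (I2 A) 0"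
  unfolding sos_modulo_def by (auto intro!: exI[of _ "0::nat"])

lemma sos_modulo_square:
  assumes "p \<in> poly_ring A" "total_degree p \<le> \<tau>" "p ^ 2 - p \<in> I2 A"
  shows "sos_modulo A \<tau> (I2 A) p"
  unfolding sos_modulo_def
  using assms I2_uminus[OF assms(3)]
  by (auto intro!: exI[of _ "1::nat"] exI[of _ "\<lambda>_. p"])

lemma sos_modulo_add:
  assumes "sos_modulo A \<tau> (I2 A) p" "sos_modulo A \<tau> (I2 A) p'"
  shows "sos_modulo A \<tau> (I2 A) (p + p')"
proof -
  obtain m :: nat and q where q: "\<forall>r<m. q r \<in> poly_ring A \<and> total_degree (q r) \<le> \<tau>"
    "p - (\<Sum>r<m. q r ^ 2) \<in> I2 A"
    using assms(1) unfolding sos_modulo_def by blast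
  obtain m' :: nat and q' where q': "\<forall>r<m'. q' r \<in> poly_ring A \<and> total_degree (q' r) \<le> \<tau>"
    "p' - (\<Sum>r<m'. q' r ^ 2) \<in> I2 A"
    using assms(2) unfolding sos_modulo_def by blast
  define s where "s r = (if r < m then q r else q' (r - m))" for r :: nat
  have "(\<Sum>r<m + m'. s r ^ 2) = (\<Sum>r<m. s r ^ 2) + (\<Sum>r<m'. s (m + r) ^ 2)"
    by (induction m') (simp_all add: add.assoc)
  also have "\<dots> = (\<Sum>r<m. q r ^ 2) + (\<Sum>r<m'. q' r ^ 2)"
    by (simp add: s_def)
  finally have "p + p' - (\<Sum>r<m + m'. s r ^ 2) =
      (p - (\<Sum>r<m. q r ^ 2)) + (p' - (\<Sum>r<m'. q' r ^ 2))"
    by simp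
  moreover have "\<forall>r<m + m'. s r \<in> poly_ring A \<and> total_degree (s r) \<le> \<tau>"
    using q(1) q'(1) by (auto simp: s_def)
  ultimately show ?thesis
    unfolding sos_modulo_def using I2_add[OF q(2) q'(2)] by metis
qed

lemma sos_modulo_sum:
  assumes "\<And>i. i \<in> I \<Longrightarrow> sos_modulo A \<tau> (I2 A) (p i)"
  shows "sos_modulo A \<tau> (I2 A) (\<Sum>i\<in>I. p i)"
  using assms
  by (induction I rule: infinite_finite_induct) (auto intro: sos_modulo_zero sos_modulo_add)

lemma sos_modulo_const_mult:
  assumes "c \<ge> 0" "sos_modulo A \<tau> (I2 A) p"
  shows "sos_modulo A \<tau> (I2 A) (Poly_Mapping.single 0 c * p)"
proof -
  obtain m :: nat and q where q: "\<forall>r<m. q r \<in> poly_ring A \<and> total_degree (q r) \<le> \<tau>"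
    "p - (\<Sum>r<m. q r ^ 2) \<in> I2 A"
    using assms(2) unfolding sos_modulo_def by blast
  define s where "s r = Poly_Mapping.single 0 (sqrt c) * q r" for r :: nat
  have "s r ^ 2 = Poly_Mapping.single 0 c * q r ^ 2" for r
    using assms(1) by (simp add: s_def power_mult_distrib power2_eq_square[of "Poly_Mapping.single _ _"] mult_single)
  then have "Poly_Mapping.single 0 c * p - (\<Sum>r<m. s r ^ 2) =
      Poly_Mapping.single 0 c * (p - (\<Sum>r<m. q r ^ 2))"
    by (simp add: right_diff_distrib sum_distrib_left)
  moreover have "\<forall>r<m. s r \<in> poly_ring A \<and> total_degree (s r) \<le> \<tau>"
  proof (intro allI impI conjI)
    fix r assume "r < m"
    then show "s r \<in> poly_ring A"
      using q(1) by (auto simp: s_def intro!: poly_ring_mult)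
    show "total_degree (s r) \<le> \<tau>"
      using total_degree_mult_le[of "Poly_Mapping.single 0 (sqrt c)" 0 "q r" \<tau>] q(1) \<open>r < m\<close>
      by (simp add: s_def)
  qed
  ultimately show ?thesis
    unfolding sos_modulo_def using I2_mult[OF poly_ring_const q(2)] by metis
qed

section \<open>The two products of a hyperedge\<close>

text \<open>
  The top-degree part of \<open>\<Prod>\<^sub>B (1 - x\<^sub>k)\<close> is \<open>(-1)\<^bsup>|B|\<^esup> \<Prod>\<^sub>B x\<^sub>k\<close>. With the strict inequality
  the claim for \<open>B = {}\<close> says that the difference is the zero polynomial, and this starts
  the induction.
\<close>

lemma keys_prod_one_minus_X:
  assumes "finite B"
  shows "Poly_Mapping.keys ((\<Prod>k\<in>B. 1 - X k) - (- 1) ^ card B * (\<Prod>k\<in>B. X k))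
    \<subseteq> {m. monom_degree m < card B}"
  using assms
proof (induction B)
  case (insert k B)
  let ?a = "\<Prod>k\<in>B. X k" and ?b = "\<Prod>k\<in>B. 1 - X k" and ?s = "(- 1) ^ card B :: mpoly"
  let ?r = "?b - ?s * ?a"
  have "(\<Prod>k\<in>insert k B. 1 - X k) - (- 1) ^ card (insert k B) * (\<Prod>k\<in>insert k B. X k) =
      ?r * (1 - X k) + ?s * ?a"
    using insert by (simp add: algebra_simps)
  moreover have "Poly_Mapping.keys (?r * (1 - X k)) \<subseteq> {m. monom_degree m < Suc (card B)}"
    using total_degree_one_minus_X[of k] unfolding total_degree_le_iff
    by (intro keys_mult_subset[OF insert.IH]) (auto simp: monom_degree_add)
  moreover have "Poly_Mapping.keys (?s * ?a) \<subseteq> {m. monom_degree m < Suc (card B)}"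
  proof -
    have "Poly_Mapping.keys ?a \<subseteq> {m. monom_degree m < Suc (card B)}"
      using total_degree_prod_le[of B X] total_degree_X
      by (auto simp: total_degree_le_iff less_Suc_eq_le)
    then show ?thesis
      by (cases "even (card B)") (simp_all add: keys_uminus)
  qed
  ultimately show ?case
    using insert by (simp add: keys_add_subset)
qed simp

lemma sos_modulo_prod_X_add_prod_one_minus_X:
  assumes "finite B" "B \<subseteq> A" "card B \<le> Suc \<tau>" "even \<tau>"
  shows "sos_modulo A \<tau> (I2 A) ((\<Prod>k\<in>B. X k) + (\<Prod>k\<in>B. 1 - X k))"
proof -
  let ?a = "\<Prod>k\<in>B. X k" and ?b = "\<Prod>k\<in>B. 1 - X k"
  have a: "?a \<in> poly_ring A" and b: "?b \<in> poly_ring A"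
    using assms(2) by (auto intro!: poly_ring_prod poly_ring_diff poly_ring_X)
  have a_idem: "?a ^ 2 - ?a \<in> I2 A" and b_idem: "?b ^ 2 - ?b \<in> I2 A"
    using assms(2)
    by (auto intro!: I2_idempotent_prod I2_generator I2_one_minus_X poly_ring_X poly_ring_diff)
  have deg: "total_degree ?a \<le> card B" "total_degree ?b \<le> card B"
    by (rule total_degree_prod_le, rule total_degree_X total_degree_one_minus_X)+
  show ?thesis
  proof (cases "even (card B)")
    case True
    then have "card B \<le> \<tau>"
      using assms(3,4) by (metis le_SucE even_Suc)
    then show ?thesis
      using a b a_idem b_idem deg by (intro sos_modulo_add sos_modulo_square) auto
  next
    case False
    then obtain k where k: "k \<in> B" by fastforce
    (* A common index k of the two products gives x_k (1 - x_k), minus a generator of the ideal. *)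
    have "?a * ?b \<in> I2 A"
    proof -
      have "?a * ?b = (- ((\<Prod>k\<in>B - {k}. X k) * (\<Prod>k\<in>B - {k}. 1 - X k))) * (X k ^ 2 - X k)"
        using k assms(1)
        by (simp add: prod.remove[of B k] power2_eq_square algebra_simps)
      also have "\<dots> \<in> I2 A"
        using assms(2) k
        by (intro I2_mult I2_generator poly_ring_uminus poly_ring_mult poly_ring_prod
            poly_ring_diff poly_ring_X) auto
      finally show ?thesis .
    qed
    moreover have "(?a + ?b) ^ 2 - (?a + ?b) =
        (?a ^ 2 - ?a) + (?b ^ 2 - ?b) + (?a * ?b + ?a * ?b)"
      by (simp add: power2_eq_square algebra_simps)
    ultimately have "(?a + ?b) ^ 2 - (?a + ?b) \<in> I2 A"
      using a_idem b_idem by (simp only: I2_add)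
    moreover have "total_degree (?a + ?b) \<le> \<tau>"
      using keys_prod_one_minus_X[OF assms(1)] assms(3) False
      by (auto simp: total_degree_le_iff add.commute)
    ultimately show ?thesis
      using a b by (intro sos_modulo_square poly_ring_add)
  qed
qed

section \<open>The multilinear extension of the cut function\<close>

definition edge_poly :: "nat set \<Rightarrow> mpoly" where
  "edge_poly e = 1 - (\<Prod>k\<in>e. X k) - (\<Prod>k\<in>e. 1 - X k)"

lemma poly_ring_edge_poly: "edge_poly e \<in> poly_ring e"
  unfolding edge_poly_def by (auto intro!: poly_ring_diff poly_ring_prod poly_ring_X)

lemma multilinear_prod_X: "multilinear (\<Prod>k\<in>e. X k)"
proof (induction e rule: infinite_finite_induct)
  case (insert k e)
  then show ?case
    using multilinear_X_mult[of "\<Prod>k\<in>e. X k" e k] by (simp add: poly_ring_prod poly_ring_X)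
qed simp_all

lemma multilinear_prod_one_minus_X: "multilinear (\<Prod>k\<in>e. 1 - X k)"
proof (induction e rule: infinite_finite_induct)
  case (insert k e)
  have "(\<Prod>k\<in>e. 1 - X k) \<in> poly_ring e"
    by (auto intro!: poly_ring_diff poly_ring_prod poly_ring_X)
  then show ?case
    using insert multilinear_X_mult[of "\<Prod>k\<in>e. 1 - X k" e k]
    by (simp add: left_diff_distrib multilinear_diff)
qed simp_all

lemma multilinear_edge_poly: "multilinear (edge_poly e)"
  by (simp add: edge_poly_def multilinear_diff multilinear_prod_X multilinear_prod_one_minus_X)

lemma eval_edge_poly:
  assumes "finite e" "e \<noteq> {}"
  shows "eval_poly (indicator S) (edge_poly e) = (if e \<inter> S \<noteq> {} \<and> \<not> e \<subseteq> S then 1 else 0)"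
proof -
  have "(\<Prod>k\<in>e. indicator S k) = (if e \<subseteq> S then 1 else (0::real))"
    using assms(1) by (auto simp: indicator_def prod_zero_iff intro!: prod.neutral)
  moreover have "(\<Prod>k\<in>e. 1 - indicator S k) = (if e \<inter> S = {} then 1 else (0::real))"
    using assms(1) by (auto simp: indicator_def prod_zero_iff intro!: prod.neutral)
  ultimately show ?thesis
    using assms(2) by (auto simp: edge_poly_def eval_poly_diff eval_poly_prod)
qed

lemma mle_cut_function:
  assumes "hypergraph V E"
  shows "mle V (cut_function V E w) = (\<Sum>e\<in>E. Poly_Mapping.single 0 (w e) * edge_poly e)"
proof (rule mle_eqI)
  have E: "finite E" "finite e" "e \<noteq> {}" "e \<subseteq> V" if "e \<in> E" for e
    using assms that by (auto simp: hypergraph_def intro: finite_subset)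
  show "(\<Sum>e\<in>E. Poly_Mapping.single 0 (w e) * edge_poly e) \<in> poly_ring V"
    by (intro poly_ring_sum poly_ring_mult poly_ring_const)
      (use E(4) poly_ring_edge_poly poly_ring_mono in blast)
  show "multilinear (\<Sum>e\<in>E. Poly_Mapping.single 0 (w e) * edge_poly e)"
    by (intro multilinear_sum multilinear_const_mult multilinear_edge_poly)
  fix S assume "S \<subseteq> V"
  have "eval_poly (indicator S) (\<Sum>e\<in>E. Poly_Mapping.single 0 (w e) * edge_poly e) =
      (\<Sum>e\<in>E. if e \<inter> S \<noteq> {} \<and> e \<inter> (V - S) \<noteq> {} then w e else 0)"
    unfolding eval_poly_sum eval_poly_mult eval_poly_const
  proof (rule sum.cong)
    fix e assume "e \<in> E"
    note e = E[OF this]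
    then have "\<not> e \<subseteq> S \<longleftrightarrow> e \<inter> (V - S) \<noteq> {}"
      by blast
    then show "w e * eval_poly (indicator S) (edge_poly e) =
        (if e \<inter> S \<noteq> {} \<and> e \<inter> (V - S) \<noteq> {} then w e else 0)"
      by (simp add: eval_edge_poly e)
  qed simp
  also have "\<dots> = cut_function V E w S"
    using assms by (simp add: cut_function_def hypergraph_def sum.inter_filter)
  finally show "eval_poly (indicator S) (\<Sum>e\<in>E. Poly_Mapping.single 0 (w e) * edge_poly e) =
      cut_function V E w S" .
qed

lemma pdiff_prod_X:
  assumes "finite e" "i \<in> e"
  shows "pdiff i (\<Prod>k\<in>e. X k) = (\<Prod>k\<in>e - {i}. X k)"
proof -
  have "(\<Prod>k\<in>e - {i}. X k) \<in> poly_ring (e - {i})"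
    by (auto intro!: poly_ring_prod poly_ring_X)
  then show ?thesis
    using assms by (simp add: prod.remove[of e i] pdiff_X_mult)
qed

lemma pdiff_prod_one_minus_X:
  assumes "finite e" "i \<in> e"
  shows "pdiff i (\<Prod>k\<in>e. 1 - X k) = - (\<Prod>k\<in>e - {i}. 1 - X k)"
proof -
  have "(\<Prod>k\<in>e - {i}. 1 - X k) \<in> poly_ring (e - {i})"
    by (auto intro!: poly_ring_prod poly_ring_diff poly_ring_X)
  then show ?thesis
    using assms
    by (simp add: prod.remove[of e i] left_diff_distrib pdiff_diff pdiff_X_mult pdiff_eq_zero)
qed

lemma pdiff_edge_poly:
  assumes "finite e" "i \<in> e"
  shows "pdiff i (edge_poly e) = (\<Prod>k\<in>e - {i}. 1 - X k) - (\<Prod>k\<in>e - {i}. X k)"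
  using assms pdiff_eq_zero[of 1 "{}" i]
  by (simp add: edge_poly_def pdiff_diff pdiff_prod_X pdiff_prod_one_minus_X)

lemma pdiff_pdiff_edge_poly:
  assumes "finite e" "i \<noteq> j"
  shows "- pdiff i (pdiff j (edge_poly e)) =
    (if i \<in> e \<and> j \<in> e then (\<Prod>k\<in>e - {i, j}. X k) + (\<Prod>k\<in>e - {i, j}. 1 - X k) else 0)"
proof (cases "j \<in> e")
  case False
  then show ?thesis
    using pdiff_eq_zero[OF poly_ring_edge_poly False] by simp
next
  case True
  have "e - {j} - {i} = e - {i, j}" by blast
  moreover have "pdiff i (pdiff j (edge_poly e)) = 0" if "i \<notin> e"
  proof (rule pdiff_eq_zero)
    show "pdiff j (edge_poly e) \<in> poly_ring e"
      unfolding pdiff_edge_poly[OF assms(1) True]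
      by (auto intro!: poly_ring_diff poly_ring_prod poly_ring_X)
  qed (fact that)
  ultimately show ?thesis
    using assms True
    by (simp add: pdiff_edge_poly pdiff_diff pdiff_prod_X pdiff_prod_one_minus_X)
qed

theorem proposition11:
  fixes n t :: nat and E :: "nat set set" and w :: "nat set \<Rightarrow> real"
  assumes "hypergraph {1..n} E"
    and "\<And>e. e \<in> E \<Longrightarrow> w e \<ge> 0"
    and "E \<noteq> {}"
    and "t = Max (card ` E)"
    and "t \<ge> 2"
  shows "sos_submodular {1..n} (2 * nat \<lfloor>real t / 2 - 1\<rfloor>) (cut_function {1..n} E w)"
  unfolding sos_submodular_def
proof (intro ballI impI)
  fix i j assume ij: "i \<in> {1..n}" "j \<in> {1..n}" "i \<noteq> j"
  let ?A = "{1..n} - {i, j}" and ?\<tau> = "2 * nat \<lfloor>real t / 2 - 1\<rfloor>"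
  have E: "finite E" "finite e" "e \<subseteq> {1..n}" "card e \<le> t" if "e \<in> E" for e
    using assms(1,4) that by (auto simp: hypergraph_def intro: finite_subset)
  (* Rounding t/2 down to an integer loses at most 1/2, hence at most 1 after doubling. *)
  have \<tau>: "t \<le> ?\<tau> + 3"
    by linarith
  have "- pdiff i (pdiff j (mle {1..n} (cut_function {1..n} E w))) =
      (\<Sum>e\<in>E. Poly_Mapping.single 0 (w e) * (- pdiff i (pdiff j (edge_poly e))))"
    unfolding mle_cut_function[OF assms(1)] pdiff_sum pdiff_const_mult
    by (simp add: sum_negf)
  also have "sos_modulo ?A ?\<tau> (I2 ?A) \<dots>"
  proof (intro sos_modulo_sum sos_modulo_const_mult)
    fix e assume e: "e \<in> E"
    show "0 \<le> w e"
      using e by (rule assms(2))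
    show "sos_modulo ?A ?\<tau> (I2 ?A) (- pdiff i (pdiff j (edge_poly e)))"
    proof (cases "i \<in> e \<and> j \<in> e")
      case True
      then have "card (e - {i, j}) = card e - 2"
        using ij(3) by (simp add: card_Diff_subset)
      then have "card (e - {i, j}) \<le> Suc ?\<tau>"
        using E(4)[OF e] \<tau> by linarith
      then show ?thesis
        using True E(2,3)[OF e] ij(3)
        by (auto simp: pdiff_pdiff_edge_poly intro!: sos_modulo_prod_X_add_prod_one_minus_X)
    next
      case False
      then show ?thesis
        by (simp only: pdiff_pdiff_edge_poly[OF E(2)[OF e] ij(3)] if_False sos_modulo_zero)
    qed
  qed
  finally show "sos_modulo ?A ?\<tau> (I2 ?A)
      (- pdiff i (pdiff j (mle {1..n} (cut_function {1..n} E w))))" .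
qed

end
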